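(* Let $P\subset\mathbb{R}^n$ be an $n$-dimensional lattice-face polytope. (i) If $P=-P$, then for $1\le j\le i\le n$, $\lambda_j(\pi^{(n-i)}(P),\mathbb{Z}^i)\geq\lambda_j(P)$. (ii) If $0$ is a vertex of $P$ and $SP=\operatorname{conv}(P\cup -P)$, then for $1\le j\le i\le n$, $\lambda_j(\pi^{(n-i)}(SP),\mathbb{Z}^i)\geq\lambda_j(SP)$.
   Context: For $1\le i\le n$ let $\pi^{(n-i)}:\mathbb{R}^n\to\mathbb{R}^i$ be the projection forgetting the last $n-i$ coordinates ($\pi^{(0)}$ the identity). A polytope $P\subset\mathbb{R}^n$ is lattice-face if for every $0\le k\le n-1$ and every subset $U$ of the vertex set of $P$ whose affine hull $\mathrm{aff}(U)$ is $k$-dimensional, $\pi^{(n-k)}(\mathrm{aff}(U)\cap\mathbb{Z}^n)=\mathbb{Z}^k$. For a $0$-symmetric convex body $K\subset\mathbb{R}^d$ and lattice $\Lambda\subset\mathbb{R}^d$, $\lambda_j(K,\Lambda)=\min\{\lambda>0:\dim(\lambda K\cap\Lambda)\ge j\}$ (dimension of affine hull), and $\lambda_j(K)=\lambda_j(K,\mathbb{Z}^n)$ for $K\subset\mathbb{R}^n$. *)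

theory Defs
  imports "HOL-Analysis.Analysis"
begin

text \<open>R^n is modelled as real^'n with a linearly ordered finite index type, n = CARD('n).
  The coordinate order is the order on 'n; rk k is the position (0-based) of coordinate k.
  R^i (i \<le> n) is identified with the coordinate subspace of the first i coordinates.\<close>

definition rk :: "'n::{finite,linorder} \<Rightarrow> nat" where
  "rk k = card {l. l < k}"

text \<open>pi^(n-i): forget the last n-i coordinates (embedded: set them to 0).\<close>
definition proj :: "nat \<Rightarrow> real^'n::{finite,linorder} \<Rightarrow> real^'n::{finite,linorder}" where
  "proj i x = (\<chi> k. if rk k < i then x $ k else 0)"

text \<open>Z^i, embedded as the integer points of the first-i coordinate subspace.\<close>
definition Zlat :: "nat \<Rightarrow> (real^'n::{finite,linorder}) set" where
  "Zlat i = {x. (\<forall>k. x $ k \<in> \<int>) \<and> (\<forall>k. i \<le> rk k \<longrightarrow> x $ k = 0)}"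

definition vertices :: "(real^'n::{finite,linorder}) set \<Rightarrow> (real^'n::{finite,linorder}) set" where
  "vertices P = {v. v extreme_point_of P}"

definition lattice_face :: "(real^'n::{finite,linorder}) set \<Rightarrow> bool" where
  "lattice_face P \<longleftrightarrow>
     (\<forall>k < CARD('n). \<forall>U. U \<subseteq> vertices P \<longrightarrow> aff_dim (affine hull U) = int k \<longrightarrow>
        proj k ` (affine hull U \<inter> Zlat CARD('n)) = Zlat k)"

text \<open>lambda_j(K, Lambda) = min {l > 0. dim aff(l K \<inter> Lambda) \<ge> j}\<close>
definition succ_min :: "nat \<Rightarrow> (real^'n::{finite,linorder}) set \<Rightarrow> (real^'n::{finite,linorder}) set \<Rightarrow> real" where
  "succ_min j K L = Inf {l. l > 0 \<and> aff_dim (((*\<^sub>R) l ` K) \<inter> L) \<ge> int j}"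

end

theory Submission
  imports Defs
begin

text \<open>Both bodies in question are the symmetrisation K = conv(V \<union> -V) of the vertex set V of P
  (for P = -P this is P itself). Given a lattice point y = l \<pi>(w) with w \<in> K, a Caratheodory-type
  reduction replaces w by a point x' \<in> K with the same projection that lies in the span of
  signed vertices whose projections form a basis of R^i. Under either hypothesis that span is
  the affine hull of a set of vertices of P, so by the lattice-face property \<pi> maps its integer
  points onto Z^i, injectively; hence l x' is a lattice point of l K above y. So
  l \<pi>(K) \<inter> Z^i \<subseteq> \<pi>(l K \<inter> Z^n), and as \<pi> does not raise dimension, every dilation factor
  counted in \<lambda>_j(\<pi>(K), Z^i) is counted in \<lambda>_j(K).\<close>

section \<open>Coordinate projections\<close>

lemma rk_strict_mono: "strict_mono (rk :: 'n::{finite,linorder} \<Rightarrow> nat)"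
  unfolding strict_mono_def rk_def by (auto intro!: psubset_card_mono)

lemma rk_less_card: "rk (k::'n::{finite,linorder}) < CARD('n)"
  unfolding rk_def by (rule psubset_card_mono) auto

lemma range_rk: "range (rk :: 'n::{finite,linorder} \<Rightarrow> nat) = {..<CARD('n)}"
proof (rule card_subset_eq[OF finite_lessThan])
  show "range (rk :: 'n \<Rightarrow> nat) \<subseteq> {..<CARD('n)}"
    using rk_less_card[where 'n='n] by auto
  show "card (range (rk :: 'n \<Rightarrow> nat)) = card {..<CARD('n)}"
    by (simp add: card_image strict_mono_imp_inj_on[OF rk_strict_mono])
qed

lemma card_rk_less:
  assumes "i \<le> CARD('n)"
  shows "card {k::'n::{finite,linorder}. rk k < i} = i"
proof -
  have "rk ` {k::'n. rk k < i} = range (rk :: 'n \<Rightarrow> nat) \<inter> {..<i}"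
    by blast
  also have "\<dots> = {..<i}"
    using range_rk[where 'n='n] assms by auto
  finally have "rk ` {k::'n. rk k < i} = {..<i}" .
  then show ?thesis
    using card_image[OF inj_on_subset[OF strict_mono_imp_inj_on[OF rk_strict_mono]]]
    by (metis card_lessThan subset_UNIV)
qed

lemma linear_proj: "linear (proj i :: real^'n::{finite,linorder} \<Rightarrow> real^'n::{finite,linorder})"
  by (rule linearI) (auto simp: proj_def vec_eq_iff)

lemma proj_id: "CARD('n) \<le> i \<Longrightarrow> proj i (x::real^'n::{finite,linorder}) = x"
  using rk_less_card[where 'n='n] by (auto simp: proj_def vec_eq_iff intro: less_le_trans)

lemma dim_range_proj:
  assumes "i \<le> CARD('n)"
  shows "dim (range (proj i :: real^'n::{finite,linorder} \<Rightarrow> real^'n::{finite,linorder})) = i"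
proof -
  have "range (proj i :: real^'n::{finite,linorder} \<Rightarrow> real^'n::{finite,linorder})
      = {x. \<forall>k. k \<notin> {k. rk k < i} \<longrightarrow> x $ k = 0}" (is "_ = ?Z")
  proof
    show "range (proj i) \<subseteq> ?Z"
      by (auto simp: proj_def)
    show "?Z \<subseteq> range (proj i)"
    proof
      fix x assume "x \<in> ?Z"
      then have "x = proj i x" by (auto simp: proj_def vec_eq_iff)
      then show "x \<in> range (proj i)" by blast
    qed
  qed
  then show ?thesis
    using dim_substandard_cart[where 'a=real, of "{k::'n. rk k < i}"] card_rk_less[OF assms]
    by (simp add: dim_vec_eq)
qed

lemma span_image_proj:
  assumes "span A = UNIV"
  shows "span (proj i ` A) = range (proj i :: real^'n::{finite,linorder} \<Rightarrow> real^'n::{finite,linorder})"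
  using span_linear_image[OF linear_proj, of i A] assms by simp

section \<open>Linear and convex preliminaries\<close>

lemma nontrivial_combination_if_not_independent_image:
  fixes f :: "'a \<Rightarrow> 'b::real_vector"
  assumes "finite S" and "\<not> (inj_on f S \<and> independent (f ` S))"
  obtains w where "\<exists>a\<in>S. w a \<noteq> 0" "(\<Sum>a\<in>S. w a *\<^sub>R f a) = 0"
proof (cases "inj_on f S")
  case False
  then obtain a b where ab: "a \<in> S" "b \<in> S" "a \<noteq> b" "f a = f b"
    by (auto simp: inj_on_def)
  define w where "w v = (if v = a then 1 else if v = b then -1 else 0 :: real)" for v
  have "(\<Sum>v\<in>S. w v *\<^sub>R f v) = (\<Sum>v\<in>{a, b}. w v *\<^sub>R f v)"
    using assms(1) ab by (intro sum.mono_neutral_right) (auto simp: w_def)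
  also have "\<dots> = 0"
    using ab by (simp add: w_def)
  finally show ?thesis
    using ab by (intro that[of w]) (auto simp: w_def)
next
  case True
  with assms have "dependent (f ` S)" by simp
  then obtain u where u: "\<exists>v\<in>f ` S. u v \<noteq> 0" "(\<Sum>v\<in>f ` S. u v *\<^sub>R v) = 0"
    using dependent_finite[of "f ` S"] assms(1) by auto
  then have "(\<Sum>a\<in>S. u (f a) *\<^sub>R f a) = 0"
    using sum.reindex[OF True, of "\<lambda>v. u v *\<^sub>R v"] by simp
  then show ?thesis
    using u(1) by (intro that[of "u \<circ> f"]) auto
qed

text \<open>Moving along a vanishing combination w with nonpositive weight sum until the first weight
  hits zero keeps the combination subconvex.\<close>

lemma subconvex_combination_eliminate:
  fixes f :: "'a \<Rightarrow> 'b::real_vector"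
  assumes S: "finite S" and u: "\<forall>x\<in>S. 0 \<le> u x" "sum u S \<le> 1"
    and w: "\<exists>x\<in>S. w x \<noteq> 0" "(\<Sum>x\<in>S. w x *\<^sub>R f x) = 0" "sum w S \<le> 0"
  obtains a u' where "a \<in> S" "u' a = 0" "\<forall>x\<in>S. 0 \<le> u' x" "sum u' S \<le> 1"
    "(\<Sum>x\<in>S. u' x *\<^sub>R f x) = (\<Sum>x\<in>S. u x *\<^sub>R f x)"
proof -
  have "\<exists>x\<in>S. w x < 0"
  proof (rule ccontr)
    assume "\<not> ?thesis"
    then have "\<forall>x\<in>S. 0 \<le> w x" by auto
    with w(3) have "\<forall>x\<in>S. w x = 0"
      using sum_nonneg_eq_0_iff[OF S] sum_nonneg[of S w] by (metis order_antisym)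
    with w(1) show False by blast
  qed
  define t where "t = Min ((\<lambda>x. u x / - w x) ` {x\<in>S. w x < 0})"
  have "t \<in> (\<lambda>x. u x / - w x) ` {x\<in>S. w x < 0}"
    unfolding t_def using S \<open>\<exists>x\<in>S. w x < 0\<close> by (intro Min_in) auto
  then obtain a where a: "a \<in> S" "w a < 0" "t = u a / - w a"
    by blast
  have t_le: "t \<le> u x / - w x" if "x \<in> S" "w x < 0" for x
    unfolding t_def using S that by (intro Min_le) auto
  have t0: "0 \<le> t"
    using a u(1) by (simp add: divide_nonneg_neg)
  define u' where "u' x = u x + t * w x" for x
  have "0 \<le> u' x" if "x \<in> S" for x
  proof (cases "w x < 0")
    case True
    then have "t * - w x \<le> u x"
      using t_le[OF that True] pos_le_divide_eq[of "- w x" t "u x"] by simp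
    then show ?thesis
      by (simp add: u'_def algebra_simps)
  next
    case False
    then show ?thesis
      using u(1) that t0 by (simp add: u'_def)
  qed
  moreover have "u' a = 0"
    using a by (simp add: u'_def)
  moreover have "sum u' S \<le> 1"
    using u(2) w(3) t0 mult_nonneg_nonpos[of t "sum w S"]
    by (simp add: u'_def sum.distrib sum_distrib_left[symmetric])
  moreover have "(\<Sum>x\<in>S. u' x *\<^sub>R f x) = (\<Sum>x\<in>S. u x *\<^sub>R f x) + t *\<^sub>R (\<Sum>x\<in>S. w x *\<^sub>R f x)"
    by (simp add: u'_def scaleR_add_left sum.distrib scaleR_sum_right)
  ultimately show ?thesis
    using a(1) w(2) that by simp
qed

lemma subconvex_combination_independent:
  fixes f :: "'a \<Rightarrow> 'b::real_vector"
  assumes "finite S" "\<forall>a\<in>S. 0 \<le> u a" "sum u S \<le> 1"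
  shows "\<exists>T v. T \<subseteq> S \<and> (\<forall>a\<in>T. 0 \<le> v a) \<and> sum v T \<le> 1 \<and>
           (\<Sum>a\<in>T. v a *\<^sub>R f a) = (\<Sum>a\<in>S. u a *\<^sub>R f a) \<and> inj_on f T \<and> independent (f ` T)"
  using assms
proof (induction "card S" arbitrary: S u rule: less_induct)
  case less
  show ?case
  proof (cases "inj_on f S \<and> independent (f ` S)")
    case True
    with less.prems show ?thesis
      by (intro exI[of _ S] exI[of _ u]) simp
  next
    case False
    then obtain w where w: "\<exists>a\<in>S. w a \<noteq> 0" "(\<Sum>a\<in>S. w a *\<^sub>R f a) = 0"
      using nontrivial_combination_if_not_independent_image less.prems(1) by blast
    define w' where "w' = (if sum w S \<le> 0 then w else (\<lambda>a. - w a))"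
    have w': "\<exists>a\<in>S. w' a \<noteq> 0" "(\<Sum>a\<in>S. w' a *\<^sub>R f a) = 0" "sum w' S \<le> 0"
      using w by (auto simp: w'_def sum_negf)
    obtain a u' where a: "a \<in> S" "u' a = 0" "\<forall>x\<in>S. 0 \<le> u' x" "sum u' S \<le> 1"
      "(\<Sum>x\<in>S. u' x *\<^sub>R f x) = (\<Sum>x\<in>S. u x *\<^sub>R f x)"
      using subconvex_combination_eliminate[OF less.prems w'] by blast
    have "card (S - {a}) < card S"
      using a(1) less.prems(1) by (rule card_Diff1_less[rotated])
    moreover have "sum u' (S - {a}) \<le> 1"
      using a less.prems(1) by (simp add: sum_diff1)
    ultimately obtain T v where T: "T \<subseteq> S - {a}" "\<forall>x\<in>T. 0 \<le> v x" "sum v T \<le> 1"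
        "(\<Sum>x\<in>T. v x *\<^sub>R f x) = (\<Sum>x\<in>S - {a}. u' x *\<^sub>R f x)" "inj_on f T" "independent (f ` T)"
      using less.hyps[of "S - {a}" u'] less.prems(1) a(3) by auto
    moreover have "(\<Sum>x\<in>S - {a}. u' x *\<^sub>R f x) = (\<Sum>x\<in>S. u x *\<^sub>R f x)"
      using a less.prems(1) by (simp add: sum_diff1)
    ultimately show ?thesis
      by (intro exI[of _ T] exI[of _ v]) auto
  qed
qed

lemma convex_sum_le_1_mem:
  fixes K :: "'a::real_vector set"
  assumes "convex K" "0 \<in> K" "finite S" "S \<subseteq> K" "\<forall>a\<in>S. 0 \<le> u a" "sum u S \<le> 1"
  shows "(\<Sum>a\<in>S. u a *\<^sub>R a) \<in> K"
proof (cases "sum u S = 0")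
  case True
  then have "\<forall>a\<in>S. u a = 0"
    using sum_nonneg_eq_0_iff[OF assms(3)] assms(5) by blast
  then show ?thesis
    using assms(2) by simp
next
  case False
  define s where "s = sum u S"
  have s0: "0 < s"
    using False assms(5) sum_nonneg[of S u] unfolding s_def by force
  have "(\<Sum>a\<in>S. (u a / s) *\<^sub>R a) \<in> K"
    using assms s0 by (intro convex_sum) (auto simp: s_def sum_divide_distrib[symmetric])
  then have "s *\<^sub>R (\<Sum>a\<in>S. (u a / s) *\<^sub>R a) + (1 - s) *\<^sub>R 0 \<in> K"
    using s0 assms(6) unfolding s_def by (intro convexD[OF assms(1) _ assms(2)]) auto
  then show ?thesis
    using s0 by (simp add: scaleR_sum_right)
qed

lemma independent_image_extend:
  fixes f :: "'a \<Rightarrow> 'b::real_vector"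
  assumes "S \<subseteq> A" "inj_on f S" "independent (f ` S)"
  obtains U where "S \<subseteq> U" "U \<subseteq> A" "inj_on f U" "independent (f ` U)" "span (f ` U) = span (f ` A)"
proof -
  obtain B where B: "f ` S \<subseteq> B" "B \<subseteq> f ` A" "independent B" "f ` A \<subseteq> span B"
    using maximal_independent_subset_extend[of "f ` S" "f ` A"] assms by blast
  define g where "g b = (if b \<in> f ` S then inv_into S f b else inv_into A f b)" for b
  have fg: "f (g b) = b" and gA: "g b \<in> A" if "b \<in> B" for b
    using that B(2) assms(1) by (auto simp: g_def f_inv_into_f inv_into_into)
  have gf: "g (f s) = s" if "s \<in> S" for s
    using that assms(2) by (simp add: g_def)
  have fU: "f ` g ` B = B"
    using fg by (force simp: image_image)
  show ?thesis
  proof (rule that[of "g ` B"])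
    show "S \<subseteq> g ` B"
      using B(1) gf by (force simp: image_iff)
    show "inj_on f (g ` B)"
      by (rule inj_on_inverseI[of _ g]) (auto simp: fg)
    show "span (f ` g ` B) = span (f ` A)"
      using B(2,4) by (simp add: fU span_eq span_superset subset_trans)
  qed (use gA B(3) fU in auto)
qed

lemma symmetric_convex_hull_ball:
  fixes A :: "'a::euclidean_space set"
  assumes "uminus ` A = A" "span A = UNIV"
  obtains e where "0 < e" "ball 0 e \<subseteq> convex hull A"
proof -
  obtain a where a: "a \<in> A"
    using assms(2) nonzero_Basis[of "SOME b. b \<in> Basis"] by (metis SOME_Basis empty_iff span_empty
        UNIV_I ex_in_conv singletonD)
  have "- a \<in> A"
    using a assms(1) by force
  then have "(1/2) *\<^sub>R a + (1/2) *\<^sub>R (- a) \<in> affine hull A"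
    using a by (intro mem_affine affine_affine_hull) (auto intro: hull_inc)
  then have "affine hull A = UNIV"
    using assms(2) by (simp add: affine_hull_span_0)
  then have "interior (convex hull A) = rel_interior (convex hull A)"
    by (simp add: rel_interior_interior affine_hull_convex_hull)
  then obtain x where x: "x \<in> interior (convex hull A)"
    using a rel_interior_eq_empty[of "convex hull A"] hull_inc[OF a, of convex] by auto
  have "uminus ` (convex hull A) = convex hull A"
    using convex_hull_linear_image[OF linear_uminus, of A] assms(1) by simp
  then have "- x \<in> interior (convex hull A)"
    using x interior_negations[of "convex hull A"] by force
  then have "(1/2) *\<^sub>R x + (1/2) *\<^sub>R (- x) \<in> interior (convex hull A)"
    using x by (intro convexD convex_interior convex_convex_hull) auto
  then show ?thesis
    using that by (auto simp: mem_interior)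
qed

section \<open>Lifting lattice points along the projection\<close>

lemma proj_axis: "rk k < i \<Longrightarrow> proj i (axis k c) = (axis k c :: real^'n::{finite,linorder})"
  by (auto simp: proj_def axis_def vec_eq_iff)

lemma axis_in_Zlat: "rk k < i \<Longrightarrow> (axis k 1 :: real^'n::{finite,linorder}) \<in> Zlat i"
  by (auto simp: Zlat_def axis_def)

lemma proj_scaleR_sum:
  "proj i (\<Sum>a\<in>T. v a *\<^sub>R a) = (\<Sum>a\<in>T. v a *\<^sub>R proj i (a::real^'n::{finite,linorder}))"
  by (simp add: linear_sum[OF linear_proj] linear_scale[OF linear_proj])

lemma proj_convex_hull_representative:
  fixes A :: "(real^'n::{finite,linorder}) set"
  assumes A: "finite A" "0 \<in> convex hull A" "span A = UNIV" and i: "i \<le> CARD('n)"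
    and w: "w \<in> convex hull A"
  obtains U x where "U \<subseteq> A" "dim (span U) = i" "inj_on (proj i) (span U)"
    "x \<in> convex hull A" "x \<in> span U" "proj i x = proj i w"
proof -
  obtain c where c: "\<forall>a\<in>A. 0 \<le> c a" "sum c A = 1" "(\<Sum>a\<in>A. c a *\<^sub>R a) = w"
    using w by (auto simp: convex_hull_finite[OF A(1)])
  obtain S v where S: "S \<subseteq> A" "\<forall>a\<in>S. 0 \<le> v a" "sum v S \<le> 1"
      "(\<Sum>a\<in>S. v a *\<^sub>R proj i a) = (\<Sum>a\<in>A. c a *\<^sub>R proj i a)"
      "inj_on (proj i) S" "independent (proj i ` S)"
    using subconvex_combination_independent[OF A(1) c(1), of "proj i"] c(2) by auto
  obtain U where U: "S \<subseteq> U" "U \<subseteq> A" "inj_on (proj i) U" "independent (proj i ` U)"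
      "span (proj i ` U) = span (proj i ` A)"
    using independent_image_extend[OF S(1,5,6)] .
  have "card U = i"
    using dim_span_eq_card_independent[OF U(4)] card_image[OF U(3)]
    by (simp add: U(5) span_image_proj[OF A(3)] dim_range_proj[OF i])
  moreover have "dim U \<le> card U"
    using finite_subset[OF U(2) A(1)] by (rule dim_le_card')
  moreover have "card U \<le> dim U"
    using dim_image_le[OF linear_proj[of i], of U] dim_eq_card_independent[OF U(4)] card_image[OF U(3)]
    by simp
  ultimately have dim_U: "dim (span U) = i"
    by (simp add: dim_span)
  have inj: "inj_on (proj i) (span U)"
    using linear_inj_on_span_independent_image[OF linear_proj U(4,3)] .
  have in_hull: "(\<Sum>a\<in>S. v a *\<^sub>R a) \<in> convex hull A"
    using S A(2) finite_subset[OF S(1) A(1)] hull_subset[of A convex]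
    by (intro convex_sum_le_1_mem) auto
  have in_span: "(\<Sum>a\<in>S. v a *\<^sub>R a) \<in> span U"
    using S(1) U(1) by (intro span_sum span_scale span_base) auto
  have "proj i (\<Sum>a\<in>S. v a *\<^sub>R a) = proj i w"
    unfolding proj_scaleR_sum S(4) c(3)[symmetric] ..
  then show ?thesis
    by (rule that[OF U(2) dim_U inj in_hull in_span])
qed

lemma proj_lattice_points_lift:
  fixes A :: "(real^'n::{finite,linorder}) set"
  assumes A: "finite A" "0 \<in> convex hull A" "span A = UNIV" and i: "i \<le> CARD('n)"
    and lattice: "\<And>U. U \<subseteq> A \<Longrightarrow> dim (span U) = i \<Longrightarrow> proj i ` (span U \<inter> Zlat CARD('n)) = Zlat i"
  shows "(*\<^sub>R) l ` proj i ` (convex hull A) \<inter> Zlat i \<subseteq> proj i ` ((*\<^sub>R) l ` (convex hull A) \<inter> Zlat CARD('n))"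
proof
  fix y assume y: "y \<in> (*\<^sub>R) l ` proj i ` (convex hull A) \<inter> Zlat i"
  then obtain w where w: "w \<in> convex hull A" "y = l *\<^sub>R proj i w"
    by auto
  obtain U x where U: "U \<subseteq> A" "dim (span U) = i" "inj_on (proj i) (span U)"
      and x: "x \<in> convex hull A" "x \<in> span U" "proj i x = proj i w"
    using proj_convex_hull_representative[OF A i w(1)] .
  have "y \<in> proj i ` (span U \<inter> Zlat CARD('n))"
    using lattice[OF U(1,2)] y by simp
  then obtain z where z: "z \<in> span U" "z \<in> Zlat CARD('n)" "y = proj i z"
    by auto
  have "proj i z = proj i (l *\<^sub>R x)"
    using w(2) x(3) z(3) by (simp add: linear_scale[OF linear_proj])
  then have "z = l *\<^sub>R x"
    using inj_onD[OF U(3) _ z(1) span_scale[OF x(2)]] by blast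
  then have "z \<in> (*\<^sub>R) l ` (convex hull A) \<inter> Zlat CARD('n)"
    using x(1) z(2) by blast
  then show "y \<in> proj i ` ((*\<^sub>R) l ` (convex hull A) \<inter> Zlat CARD('n))"
    using z(3) by (rule rev_image_eqI)
qed

section \<open>Successive minima\<close>

lemma succ_min_mono:
  assumes "\<And>l. 0 < l \<Longrightarrow> aff_dim ((*\<^sub>R) l ` K' \<inter> L') \<le> aff_dim ((*\<^sub>R) l ` K \<inter> L)"
    and "\<exists>l>0. int j \<le> aff_dim ((*\<^sub>R) l ` K' \<inter> L')"
  shows "succ_min j K L \<le> succ_min j K' L'"
  unfolding succ_min_def
proof (rule cInf_superset_mono)
  show "{l. 0 < l \<and> int j \<le> aff_dim ((*\<^sub>R) l ` K' \<inter> L')} \<noteq> {}"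
    using assms(2) by blast
  show "bdd_below {l. 0 < l \<and> int j \<le> aff_dim ((*\<^sub>R) l ` K \<inter> L)}"
    by (rule bdd_belowI[of _ 0]) simp
  show "{l. 0 < l \<and> int j \<le> aff_dim ((*\<^sub>R) l ` K' \<inter> L')}
          \<subseteq> {l. 0 < l \<and> int j \<le> aff_dim ((*\<^sub>R) l ` K \<inter> L)}"
    using assms(1) by (fastforce intro: order_trans)
qed

lemma aff_dim_dilated_proj_ge:
  fixes K :: "(real^'n::{finite,linorder}) set"
  assumes e: "0 < e" "ball 0 e \<subseteq> K" and j: "j \<le> i" "j \<le> CARD('n)"
  shows "int j \<le> aff_dim ((*\<^sub>R) (2 / e) ` proj i ` K \<inter> Zlat i)"
proof -
  define E where "E = (\<lambda>k. axis k (1::real)) ` {k::'n. rk k < j}"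
  have "axis k 1 \<in> (*\<^sub>R) (2 / e) ` proj i ` K \<inter> Zlat i" if "rk k < j" for k
  proof -
    have "(e / 2) *\<^sub>R axis k 1 \<in> K"
      using e by (intro subsetD[OF e(2)]) (simp add: norm_axis_1)
    moreover have "axis k 1 = (2 / e) *\<^sub>R proj i ((e / 2) *\<^sub>R axis k (1::real))"
      using that j e(1) by (simp add: linear_scale[OF linear_proj] proj_axis)
    ultimately show ?thesis
      using axis_in_Zlat[of k i] that j(1) by auto
  qed
  moreover have "0 \<in> (*\<^sub>R) (2 / e) ` proj i ` K \<inter> Zlat i"
  proof -
    have "0 \<in> K"
      using e by auto
    moreover have "(0::real^'n::{finite,linorder}) = (2 / e) *\<^sub>R proj i 0"
      by (simp add: linear_0[OF linear_proj])
    ultimately show ?thesis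
      by (auto simp: Zlat_def)
  qed
  ultimately have sub: "insert 0 E \<subseteq> (*\<^sub>R) (2 / e) ` proj i ` K \<inter> Zlat i"
    by (auto simp: E_def)
  have "int j = int (card E)"
    unfolding E_def using card_rk_less[OF j(2)]
    by (subst card_image) (auto simp: inj_on_def axis_eq_axis)
  also have "\<dots> \<le> int (dim (insert 0 E))"
    unfolding E_def by (intro of_nat_mono independent_card_le_dim independent_mono[OF independent_Basis])
      (auto simp: Basis_vec_def)
  also have "\<dots> = aff_dim (insert 0 E)"
    by (simp add: aff_dim_zero hull_inc)
  also have "\<dots> \<le> aff_dim ((*\<^sub>R) (2 / e) ` proj i ` K \<inter> Zlat i)"
    by (rule aff_dim_subset[OF sub])
  finally show ?thesis .
qed

lemma succ_min_proj_convex_hull_ge: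
  fixes A :: "(real^'n::{finite,linorder}) set"
  assumes A: "finite A" "uminus ` A = A" "span A = UNIV" and ij: "j \<le> i" "i \<le> CARD('n)"
    and lattice: "\<And>U. i < CARD('n) \<Longrightarrow> U \<subseteq> A \<Longrightarrow> dim (span U) = i
                   \<Longrightarrow> proj i ` (span U \<inter> Zlat CARD('n)) = Zlat i"
  shows "succ_min j (convex hull A) (Zlat CARD('n)) \<le> succ_min j (proj i ` (convex hull A)) (Zlat i)"
proof (rule succ_min_mono)
  obtain e where e: "0 < e" "ball 0 e \<subseteq> convex hull A"
    using symmetric_convex_hull_ball[OF A(2,3)] .
  show "\<exists>l>0. int j \<le> aff_dim ((*\<^sub>R) l ` proj i ` (convex hull A) \<inter> Zlat i)"
    using aff_dim_dilated_proj_ge[OF e ij(1)] ij e(1) by (intro exI[of _ "2 / e"]) simp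
  have "aff_dim ((*\<^sub>R) l ` proj i ` (convex hull A) \<inter> Zlat i)
          \<le> aff_dim ((*\<^sub>R) l ` (convex hull A) \<inter> Zlat CARD('n))" for l
  proof (cases "i < CARD('n)")
    case True
    have "0 \<in> convex hull A"
      using e by auto
    then have "aff_dim ((*\<^sub>R) l ` proj i ` (convex hull A) \<inter> Zlat i)
          \<le> aff_dim (proj i ` ((*\<^sub>R) l ` (convex hull A) \<inter> Zlat CARD('n)))"
      by (intro aff_dim_subset proj_lattice_points_lift[OF A(1) _ A(3) ij(2) lattice[OF \<open>i < CARD('n)\<close>]])
    also have "\<dots> \<le> aff_dim ((*\<^sub>R) l ` (convex hull A) \<inter> Zlat CARD('n))"
      by (rule aff_dim_linear_image_le[OF linear_proj])
    finally show ?thesis .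
  next
    case False
    then show ?thesis
      using ij proj_id[where 'n='n and i=i] by simp
  qed
  then show "\<And>l. 0 < l \<Longrightarrow> aff_dim ((*\<^sub>R) l ` proj i ` (convex hull A) \<inter> Zlat i)
                 \<le> aff_dim ((*\<^sub>R) l ` (convex hull A) \<inter> Zlat CARD('n))" .
qed

section \<open>Lattice-face polytopes\<close>

text \<open>The two alternative hypotheses (P = -P, or 0 a vertex of P) enter only through this property.\<close>

definition signed_vertex_spans_are_hulls :: "(real^'n::{finite,linorder}) set \<Rightarrow> bool" where
  "signed_vertex_spans_are_hulls P \<longleftrightarrow>
     (\<forall>U \<subseteq> vertices P \<union> uminus ` vertices P. U \<noteq> {} \<longrightarrow>
        (\<exists>X \<subseteq> vertices P. affine hull X = span U))"

lemma polytope_vertices: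
  fixes P :: "(real^'n::{finite,linorder}) set"
  assumes "polytope P"
  shows "finite (vertices P)" "P = convex hull vertices P"
  using finite_polyhedron_extreme_points[OF polytope_imp_polyhedron[OF assms]]
    Krein_Milman_Minkowski[OF polytope_imp_compact[OF assms] polytope_imp_convex[OF assms]]
  by (simp_all add: vertices_def)

lemma extreme_point_of_uminus:
  fixes S :: "'a::real_vector set"
  shows "x extreme_point_of (uminus ` S) \<longleftrightarrow> - x extreme_point_of S"
proof -
  have seg: "y \<in> open_segment (- a) (- b) \<longleftrightarrow> - y \<in> open_segment a b" for y a b :: 'a
    using inj_image_mem_iff[OF inj_uminus, of "- y" "open_segment a b"]
    by (simp add: open_segment_linear_image[OF linear_uminus inj_uminus])
  have mem: "y \<in> uminus ` S \<longleftrightarrow> - y \<in> S" for y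
    by force
  show ?thesis
    by (auto simp: extreme_point_of_def Ball_image_comp mem seg)
qed

lemma vertices_uminus: "vertices (uminus ` P) = uminus ` vertices P"
  by (force simp: vertices_def extreme_point_of_uminus image_iff)

lemma symmetric_signed_vertex_spans_are_hulls:
  assumes "uminus ` P = P"
  shows "signed_vertex_spans_are_hulls P"
  unfolding signed_vertex_spans_are_hulls_def
proof (intro allI impI)
  fix U assume U: "U \<subseteq> vertices P \<union> uminus ` vertices P" "U \<noteq> {}"
  have "uminus ` vertices P = vertices P"
    using vertices_uminus[of P] assms by simp
  then have X: "U \<union> uminus ` U \<subseteq> vertices P"
    using U(1) by auto
  obtain u where "u \<in> U"
    using U(2) by blast
  then have "(1/2) *\<^sub>R u + (1/2) *\<^sub>R (- u) \<in> affine hull (U \<union> uminus ` U)"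
    by (intro mem_affine affine_affine_hull) (auto intro: hull_inc)
  then have "affine hull (U \<union> uminus ` U) = span (U \<union> uminus ` U)"
    by (intro affine_hull_span_0) simp
  also have "\<dots> = span U"
    by (auto simp: span_eq intro: span_base span_neg)
  finally show "\<exists>X\<subseteq>vertices P. affine hull X = span U"
    using X by blast
qed

lemma zero_vertex_signed_vertex_spans_are_hulls:
  assumes "0 \<in> vertices P"
  shows "signed_vertex_spans_are_hulls P"
  unfolding signed_vertex_spans_are_hulls_def
proof (intro allI impI)
  fix U assume U: "U \<subseteq> vertices P \<union> uminus ` vertices P"
  define X where "X = insert 0 {v \<in> vertices P. v \<in> U \<or> - v \<in> U}"
  have "affine hull X = span X"
    by (simp add: X_def affine_hull_span_0 hull_inc)
  also have "\<dots> = span U"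
  proof (unfold span_eq, intro conjI subsetI)
    fix x assume "x \<in> X"
    then show "x \<in> span U"
      unfolding X_def by (auto intro: span_base span_zero dest: span_neg[OF span_base])
  next
    fix u assume "u \<in> U"
    then consider "u \<in> X" | "- u \<in> X"
      using U by (force simp: X_def)
    then show "u \<in> span X"
      by cases (auto dest: span_neg[OF span_base] intro: span_base)
  qed
  finally have "affine hull X = span U" .
  moreover have "X \<subseteq> vertices P"
    using assms by (auto simp: X_def)
  ultimately show "\<exists>X\<subseteq>vertices P. affine hull X = span U"
    by blast
qed

lemma succ_min_proj_symmetrization_ge:
  fixes P :: "(real^'n::{finite,linorder}) set"
  assumes P: "polytope P" "aff_dim P = int CARD('n)" "lattice_face P" "signed_vertex_spans_are_hulls P"
    and ij: "1 \<le> j" "j \<le> i" "i \<le> CARD('n)"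
  shows "succ_min j (convex hull (P \<union> uminus ` P)) (Zlat CARD('n))
           \<le> succ_min j (proj i ` (convex hull (P \<union> uminus ` P))) (Zlat i)"
proof -
  define V where "V = vertices P"
  have V: "finite V" "P = convex hull V"
    using polytope_vertices[OF P(1)] by (simp_all add: V_def)
  have neg: "uminus ` P = convex hull (uminus ` V)"
    using V(2) convex_hull_linear_image[OF linear_uminus] by metis
  have "convex hull (V \<union> uminus ` V) = convex hull (convex hull V \<union> convex hull (uminus ` V))"
    by (metis hull_Un_left hull_Un_right)
  then have hull: "convex hull (P \<union> uminus ` P) = convex hull (V \<union> uminus ` V)"
    unfolding neg by (subst V(2)) (rule sym)
  have "affine hull V = UNIV"
    using P(2) V(2) aff_dim_convex_hull[of V] aff_dim_eq_full[of V] by simp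
  then have span: "span (V \<union> uminus ` V) = UNIV"
    using affine_hull_subset_span[of V] span_mono[of V "V \<union> uminus ` V"] by auto
  have sym: "uminus ` (V \<union> uminus ` V) = V \<union> uminus ` V"
    by (auto simp: image_Un image_image)
  show ?thesis
    unfolding hull
  proof (rule succ_min_proj_convex_hull_ge[OF finite_UnI[OF V(1) finite_imageI[OF V(1)]] sym span ij(2,3)])
    fix U assume U: "i < CARD('n)" "U \<subseteq> V \<union> uminus ` V" "dim (span U) = i"
    then have "U \<noteq> {}"
      using ij(1,2) by auto
    then obtain X where X: "X \<subseteq> vertices P" "affine hull X = span U"
      using P(4) U(2) unfolding signed_vertex_spans_are_hulls_def V_def by blast
    then have "aff_dim (affine hull X) = int i"
      using U(3) by (simp add: aff_dim_subspace)
    then show "proj i ` (span U \<inter> Zlat CARD('n)) = Zlat i"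
      using P(3) U(1) X unfolding lattice_face_def by metis
  qed
qed

theorem lemma3p3:
  fixes P :: "(real^'n::{finite,linorder}) set"
  assumes "polytope P" and "aff_dim P = int CARD('n)" and "lattice_face P"
  shows "(P = uminus ` P \<longrightarrow>
            (\<forall>i j. 1 \<le> j \<and> j \<le> i \<and> i \<le> CARD('n) \<longrightarrow>
               succ_min j (proj i ` P) (Zlat i) \<ge> succ_min j P (Zlat CARD('n))))
       \<and> (0 \<in> vertices P \<longrightarrow>
            (\<forall>i j. 1 \<le> j \<and> j \<le> i \<and> i \<le> CARD('n) \<longrightarrow>
               succ_min j (proj i ` (convex hull (P \<union> uminus ` P))) (Zlat i)
                 \<ge> succ_min j (convex hull (P \<union> uminus ` P)) (Zlat CARD('n))))"
proof (intro conjI impI allI; elim conjE)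
  fix i j :: nat
  assume sym: "P = uminus ` P" and ij: "1 \<le> j" "j \<le> i" "i \<le> CARD('n)"
  have "convex hull (P \<union> uminus ` P) = P"
    using sym polytope_imp_convex[OF assms(1)] by (simp add: convex_hull_eq)
  then show "succ_min j (proj i ` P) (Zlat i) \<ge> succ_min j P (Zlat CARD('n))"
    using succ_min_proj_symmetrization_ge[OF assms symmetric_signed_vertex_spans_are_hulls ij]
      sym by simp
next
  fix i j :: nat
  assume "0 \<in> vertices P" and ij: "1 \<le> j" "j \<le> i" "i \<le> CARD('n)"
  then show "succ_min j (proj i ` (convex hull (P \<union> uminus ` P))) (Zlat i)
               \<ge> succ_min j (convex hull (P \<union> uminus ` P)) (Zlat CARD('n))"
    using succ_min_proj_symmetrization_ge[OF assms zero_vertex_signed_vertex_spans_are_hulls ij]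
    by simp
qed

end
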